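(* Consider a parallel network with nodes $\mathcal V=\{v_1,v_2\}$ and $n$ links, all from $v_1$ to $v_2$, with lower and upper bounds on link weights $w^l,w^u\in\mathbb R^n_{>0}$, $w^l\le w^u$. If the link capacity functions $c_i:[w_i^l,w_i^u]\to\mathbb R_{>0}$ are $\mathcal S_1$ for all $i\in\{1,\dots,n\}$, then the equivalent capacity function $\mathcal C(w_{\mathrm{eq}})$ between $v_1$ and $v_2$, given by $$\frac{\mathcal C(w_{\mathrm{eq}})}{w_{\mathrm{eq}}}=\max\Big\{\tilde z\in\mathbb R:\ \exists\, w\in\mathbb R^n_{>0},\ w_i^l\le w_i\le w_i^u,\ \tilde z\le \frac{c_i(w_i)}{w_i}\ \ \forall i\in\{1,\dots,n\},\ \sum_{i=1}^nw_i=w_{\mathrm{eq}}\Big\},$$ is also an $\mathcal S_1$ function of $w_{\mathrm{eq}}\in\big[\sum_{i=1}^nw_i^l,\sum_{i=1}^nw_i^u\big]$.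
   Context: $\mathcal S_0$ function: $\psi:[x^l,x^u]\to\mathbb R$ is $\mathcal S_0$ if it is continuous and there exist $\underline x\in[x^l,x^u]$ and $\bar x\in[\underline x,x^u]$ such that $\psi$ is strictly increasing on $[x^l,\underline x]$, constant on $[\underline x,\bar x]$, and strictly decreasing on $[\bar x,x^u]$. $\mathcal S_1$ function: $\psi:[x^l,x^u]\subset\mathbb R_{>0}\to\mathbb R$ is $\mathcal S_1$ if it is $\mathcal S_0$ and there exists $x^o\in[x^l,\underline x]$ such that $\min\partial\psi(x)>\psi(x)/x$ for all $x\in[x^l,x^o)$ and $\min\partial\psi(x)=\psi(x)/x$ for all $x\in[x^o,\underline x)$. Here $\underline x$ is the first transition point of $\psi$ as an $\mathcal S_0$ function, and $\min\partial\psi(x)$ is the minimum of the left and right derivatives of $\psi$ at $x$, assumed to exist there (only the right derivative at $x=x^l$).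
   Formalization: The 𝒮₁ property is taken, for the links and for 𝒞 alike, to include existence of the finite left derivative at the first transition point x̲ (when x̲ > x^l); without this the class is not closed under parallel composition. *)

theory Defs
  imports "HOL-Analysis.Analysis"
begin

definition S0_transitions :: "real \<Rightarrow> real \<Rightarrow> (real \<Rightarrow> real) \<Rightarrow> real \<Rightarrow> real \<Rightarrow> bool" where
  "S0_transitions xl xu \<psi> x1 x2 \<longleftrightarrow>
     x1 \<in> {xl..xu} \<and> x2 \<in> {x1..xu} \<and>
     strict_mono_on {xl..x1} \<psi> \<and>
     \<psi> constant_on {x1..x2} \<and>
     strict_antimono_on {x2..xu} \<psi>"

definition S0 :: "real \<Rightarrow> real \<Rightarrow> (real \<Rightarrow> real) \<Rightarrow> bool" where
  "S0 xl xu \<psi> \<longleftrightarrow> continuous_on {xl..xu} \<psi> \<and> (\<exists>x1 x2. S0_transitions xl xu \<psi> x1 x2)"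

text \<open>The set \<open>\<partial>\<psi>(x)\<close> of the (at most two) one-sided derivatives of
  \<open>\<psi> : [xl, xu] \<rightarrow> \<real>\<close> at \<open>x\<close>. A function on \<open>[xl, xu]\<close> is represented by a total function; the side
  conditions discard the derivatives that would depend on its values outside \<open>[xl, xu]\<close>.\<close>

definition one_sided_derivs :: "real \<Rightarrow> real \<Rightarrow> (real \<Rightarrow> real) \<Rightarrow> real \<Rightarrow> real set" where
  "one_sided_derivs xl xu \<psi> x =
     {D. xl < x \<and> (\<psi> has_real_derivative D) (at_left x)} \<union>
     {D. x < xu \<and> (\<psi> has_real_derivative D) (at_right x)}"

text \<open>The point \<open>x1\<close> below is unique, being the first maximiser of \<open>\<psi>\<close>. Existence of the
  one-sided derivatives is required on the closed segment \<open>[xl, x1]\<close>, taken from within that segment.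
  This includes the left derivative at \<open>x1\<close>: without it the class is not closed under parallel
  composition, since \<open>x1\<close> of one link can become an interior point of the rising segment of the
  equivalent capacity.\<close>

definition S1 :: "real \<Rightarrow> real \<Rightarrow> (real \<Rightarrow> real) \<Rightarrow> bool" where
  "S1 xl xu \<psi> \<longleftrightarrow> 0 < xl \<and> S0 xl xu \<psi> \<and>
     (\<exists>x1 x2. S0_transitions xl xu \<psi> x1 x2 \<and>
        (\<forall>x\<in>{xl<..x1}. \<exists>D. (\<psi> has_real_derivative D) (at_left x)) \<and>
        (\<forall>x\<in>{xl..<x1}. \<exists>D. (\<psi> has_real_derivative D) (at_right x)) \<and>
        (\<exists>xo\<in>{xl..x1}.
           (\<forall>x\<in>{xl..<xo}. Min (one_sided_derivs xl xu \<psi> x) > \<psi> x / x) \<and>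
           (\<forall>x\<in>{xo..<x1}. Min (one_sided_derivs xl xu \<psi> x) = \<psi> x / x)))"

text \<open>The links of the parallel network are indexed by the finite (nonempty) type \<open>'n\<close>.\<close>

definition feasible_ratios ::
    "real ^ 'n \<Rightarrow> real ^ 'n \<Rightarrow> ('n::finite \<Rightarrow> real \<Rightarrow> real) \<Rightarrow> real \<Rightarrow> real set" where
  "feasible_ratios wl wu c weq =
     {z. \<exists>w :: real ^ 'n.
           (\<forall>i. 0 < w $ i) \<and>
           (\<forall>i. wl $ i \<le> w $ i \<and> w $ i \<le> wu $ i \<and> z \<le> c i (w $ i) / w $ i) \<and>
           (\<Sum>i\<in>UNIV. w $ i) = weq}"

definition equivalent_capacity ::
    "real ^ 'n \<Rightarrow> real ^ 'n \<Rightarrow> ('n::finite \<Rightarrow> real \<Rightarrow> real) \<Rightarrow> real \<Rightarrow> real" where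
  "equivalent_capacity wl wu c weq = weq * (GREATEST z. z \<in> feasible_ratios wl wu c weq)"

end

theory Submission
  imports Defs
begin

text \<open>The \<open>S1\<close> condition on a capacity is really one on the ratio \<open>r(x) = c(x)/x\<close>. Since
  \<open>r'(x) = (c'(x) - c(x)/x) / x\<close> for one-sided derivatives, \<open>r\<close> rises strictly up to \<open>x\<^sup>o\<close>, is constant
  between \<open>x\<^sup>o\<close> and the first maximiser of \<open>c\<close>, and falls strictly afterwards (\<open>S1_ratio\<close>). Constancy is
  the delicate part, as only the smaller of the two one-sided derivatives of \<open>r\<close> vanishes; it holds
  because a function has only countably many local minimum values (\<open>zero_one_sided_deriv_imp_eq\<close>).

  The ratios being unimodal, the weights at which link \<open>i\<close> has ratio at least \<open>z\<close> form an interval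
  \<open>[lo i z, hi i z]\<close>. So \<open>z\<close> is attainable with total weight \<open>W\<close> iff \<open>z\<close> is at most the least peak
  \<open>M\<close> of the ratios and \<open>W\<close> lies between the sums \<open>A z\<close> and \<open>B z\<close> of the end points
  (\<open>feasible_iff\<close>). As \<open>z\<close> grows to \<open>M\<close>, \<open>A z\<close> increases from the sum of the lower bounds and \<open>B z\<close>
  decreases from the sum of the upper bounds, both continuously and, once they have left these
  bounds, strictly. Hence the maximal ratio exists, and as a function of \<open>W\<close> it is the inverse of \<open>A\<close>
  up to \<open>A M\<close>, then \<open>M\<close> up to \<open>B M\<close>, then the inverse of \<open>B\<close>.

  Up to \<open>A M\<close> the one-sided derivatives of the maximal ratio are harmonic combinations of those of the
  ratios of the links that have left their lower bounds. So they exist, and they are positive before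
  \<open>A M\<close>. On \<open>[A M, B M]\<close> the maximal ratio is constant. So the equivalent capacity \<open>C\<close>, which is \<open>W\<close>
  times this ratio, satisfies the derivative conditions with \<open>x\<^sup>o = A M\<close> and first transition point
  \<open>B M\<close> (\<open>S1_C\<close>).

  Beyond \<open>B M\<close>, \<open>C\<close> is the sum over the links of \<open>z * hi i z\<close> where \<open>z\<close> decreases. Each summand is the
  capacity of the link on the part where that is constant or falling, or, once the link is saturated,
  the ratio \<open>z\<close> times the upper bound of its weight. It is constant at first, possibly at
  a single point only, and then strictly decreasing, and a sum of such functions has the same shape.\<close>

section \<open>Monotonicity and constancy from one-sided derivatives\<close>

text \<open>The last point of \<open>[a, b]\<close> at which \<open>f\<close> is still at least \<open>f a\<close> must be \<open>b\<close>: a positive right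
  derivative at an earlier such point would produce a later one.\<close>

lemma pos_right_deriv_imp_le:
  fixes f :: "real \<Rightarrow> real"
  assumes "a \<le> b" "continuous_on {a..b} f"
    and der: "\<And>x. x \<in> {a..<b} \<Longrightarrow> \<exists>R>0. (f has_real_derivative R) (at_right x)"
  shows "f a \<le> f b"
proof -
  define S where "S = {x \<in> {a..b}. f a \<le> f x}"
  have "closed S"
    unfolding S_def using assms(2)
    by (intro continuous_on_closed_Collect_le continuous_on_const) auto
  moreover have "bounded S"
    by (rule bounded_subset[of "{a..b}"]) (auto simp: S_def)
  ultimately have "compact S"
    by (simp add: compact_eq_bounded_closed)
  moreover have "a \<in> S"
    using assms(1) by (auto simp: S_def)
  ultimately obtain s where s: "s \<in> S" "\<And>x. x \<in> S \<Longrightarrow> x \<le> s"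
    using compact_attains_sup[of S] by blast
  have "s = b"
  proof (rule ccontr)
    assume "s \<noteq> b"
    then have "s \<in> {a..<b}"
      using s(1) by (auto simp: S_def)
    then obtain R where "R > 0" "(f has_real_derivative R) (at_right s)"
      using der by blast
    then obtain d where d: "d > 0" "\<And>h. h > 0 \<Longrightarrow> h < d \<Longrightarrow> f s < f (s + h)"
      using has_real_derivative_pos_inc_right[of f R s "{s<..}"] by auto
    define h where "h = min (d / 2) (b - s)"
    have "h > 0" "h < d" "s + h \<le> b"
      using d(1) \<open>s \<in> {a..<b}\<close> by (auto simp: h_def min_def)
    then have "s + h \<in> S"
      using d(2)[of h] s(1) by (auto simp: S_def)
    then show False
      using s(2)[of "s + h"] \<open>h > 0\<close> by auto
  qed
  then show ?thesis
    using s(1) by (auto simp: S_def)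
qed

text \<open>Adding \<open>e * x\<close> makes the right derivatives positive; then \<open>e\<close> tends to 0.\<close>

lemma nonneg_right_deriv_imp_le:
  fixes f :: "real \<Rightarrow> real"
  assumes "a \<le> b" "continuous_on {a..b} f"
    and der: "\<And>x. x \<in> {a..<b} \<Longrightarrow> \<exists>R\<ge>0. (f has_real_derivative R) (at_right x)"
  shows "f a \<le> f b"
proof -
  have *: "f a \<le> f b + e * (b - a)" if "e > 0" for e
  proof -
    have "f a + e * a \<le> f b + e * b"
    proof (rule pos_right_deriv_imp_le[OF assms(1)])
      show "continuous_on {a..b} (\<lambda>x. f x + e * x)"
        by (intro continuous_intros assms(2))
      fix x assume "x \<in> {a..<b}"
      then obtain R where R: "R \<ge> 0" "(f has_real_derivative R) (at_right x)"
        using der by blast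
      have "((\<lambda>x. f x + e * x) has_real_derivative (R + e)) (at_right x)"
        using R(2) by (auto intro!: derivative_eq_intros)
      then show "\<exists>R>0. ((\<lambda>x. f x + e * x) has_real_derivative R) (at_right x)"
        using R(1) that by (intro exI[of _ "R + e"]) auto
    qed
    then show ?thesis
      by (simp add: algebra_simps)
  qed
  show ?thesis
  proof (cases "a < b")
    case True
    show ?thesis
    proof (rule field_le_epsilon)
      fix e :: real assume "e > 0"
      then show "f a \<le> f b + e"
        using *[of "e / (b - a)"] True by simp
    qed
  qed (use assms(1) in simp)
qed

lemma pos_right_deriv_imp_strict_mono_on:
  fixes f :: "real \<Rightarrow> real"
  assumes cont: "continuous_on {a..b} f"
    and der: "\<And>x. x \<in> {a..<b} \<Longrightarrow> \<exists>R>0. (f has_real_derivative R) (at_right x)"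
  shows "strict_mono_on {a..b} f"
proof (rule strict_mono_onI)
  fix x y assume xy: "x \<in> {a..b}" "y \<in> {a..b}" "x < y"
  obtain R where "R > 0" "(f has_real_derivative R) (at_right x)"
    using der[of x] xy by auto
  then obtain d where d: "d > 0" "\<And>h. h > 0 \<Longrightarrow> h < d \<Longrightarrow> f x < f (x + h)"
    using has_real_derivative_pos_inc_right[of f R x "{x<..}"] by auto
  define h where "h = min (d / 2) (y - x)"
  have h: "h > 0" "h < d" "x + h \<le> y"
    using d(1) xy(3) by (auto simp: h_def min_def)
  have "f x < f (x + h)"
    using d(2) h by blast
  also have "f (x + h) \<le> f y"
  proof (rule pos_right_deriv_imp_le[of "x + h" y f])
    show "continuous_on {x + h..y} f"
      using h xy by (auto intro: continuous_on_subset[OF cont])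
  qed (use h xy der in auto)
  finally show "f x < f y" .
qed

text \<open>The value at a local minimum is the infimum of \<open>g\<close> over an interval with rational end points, and
  there are only countably many of those.\<close>

lemma countable_local_min_values:
  fixes g :: "real \<Rightarrow> real"
  shows "countable {g s |s. \<exists>u v. u < s \<and> s < v \<and> (\<forall>x\<in>{u<..<v}. g s \<le> g x)}" (is "countable ?V")
proof -
  have "?V \<subseteq> (\<lambda>(u, v). Inf (g ` {of_rat u<..<of_rat v})) ` (UNIV :: (rat \<times> rat) set)"
  proof
    fix c assume "c \<in> ?V"
    then obtain s u v where s: "c = g s" "u < s" "s < v" "\<forall>x\<in>{u<..<v}. g s \<le> g x"
      by blast
    obtain u' v' where u': "u < of_rat u'" "of_rat u' < s" "s < of_rat v'" "of_rat v' < v"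
      using of_rat_dense[OF s(2)] of_rat_dense[OF s(3)] by blast
    have "Inf (g ` {of_rat u'<..<of_rat v'}) = c"
      using s u' by (intro cInf_eq_minimum) auto
    then show "c \<in> (\<lambda>(u, v). Inf (g ` {of_rat u<..<of_rat v})) ` (UNIV :: (rat \<times> rat) set)"
      by (intro image_eqI[of _ _ "(u', v')"]) auto
  qed
  then show ?thesis
    by (rule countable_subset) auto
qed

text \<open>This turns the pointwise condition \<open>min \<partial>\<psi>(x) = \<psi>(x)/x\<close> into constancy of \<open>\<psi>(x)/x\<close>. The mean
  value theorem does not apply, since at each point only one of the two one-sided derivatives is known
  to vanish. If \<open>f\<close> rose from \<open>a\<close> to \<open>b\<close>, tilt it by a slope \<open>k\<close> smaller than the mean slope, so that
  \<open>g x = f x - k * x\<close> still rises. For every level \<open>c\<close> between \<open>g a\<close> and \<open>g b\<close>, the last point \<open>s\<close>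
  with \<open>g s = c\<close> has right derivative at least 0 for \<open>g\<close>, hence positive for \<open>f\<close>; so the left
  derivative of \<open>f\<close> is 0 there, that of \<open>g\<close> is \<open>- k\<close>, and \<open>s\<close> is a local minimum of \<open>g\<close>. Uncountably
  many levels would thus be local minimum values.\<close>

lemma zero_one_sided_deriv_imp_eq:
  fixes f :: "real \<Rightarrow> real"
  assumes "a \<le> b" and cont: "continuous_on {a..b} f"
    and right: "\<And>x. x \<in> {a..<b} \<Longrightarrow> \<exists>R\<ge>0. (f has_real_derivative R) (at_right x) \<and>
      (R = 0 \<or> x = a \<or> (f has_real_derivative 0) (at_left x))"
  shows "f a = f b"
proof (rule antisym)
  show "f a \<le> f b"
  proof (rule nonneg_right_deriv_imp_le[OF assms(1) cont])
    show "\<exists>R\<ge>0. (f has_real_derivative R) (at_right x)" if "x \<in> {a..<b}" for x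
      using right[OF that] by auto
  qed
  show "f b \<le> f a"
  proof (rule ccontr)
    assume "\<not> f b \<le> f a"
    then have "a < b" and lt: "f a < f b"
      using assms(1) by (auto simp: le_less)
    \<comment> \<open>Half of the mean slope, so that the tilted function still rises.\<close>
    define k where "k = (f b - f a) / 2 / (b - a)"
    have "k > 0"
      using \<open>a < b\<close> lt by (simp add: k_def)
    define g where "g = (\<lambda>x. f x - k * x)"
    have "g b - g a = (f b - f a) / 2"
    proof -
      have "k * (b - a) = (f b - f a) / 2"
        using \<open>a < b\<close> k_def nonzero_eq_divide_eq[of "b - a" k "(f b - f a) / 2"] by auto
      then show ?thesis
        by (simp add: g_def algebra_simps)
    qed
    then have "g a < g b"
      using lt by simp
    have contg: "continuous_on {a..b} g"
      unfolding g_def by (intro continuous_intros cont)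
    have "{g a<..<g b} \<subseteq> {g s |s. \<exists>u v. u < s \<and> s < v \<and> (\<forall>x\<in>{u<..<v}. g s \<le> g x)}"
    proof
      fix c assume c: "c \<in> {g a<..<g b}"
      define S where "S = {x \<in> {a..b}. g x \<le> c}"
      have "closed S"
        unfolding S_def using contg
        by (intro continuous_on_closed_Collect_le continuous_on_const) auto
      moreover have "bounded S"
        by (rule bounded_subset[of "{a..b}"]) (auto simp: S_def)
      ultimately have "compact S"
        by (simp add: compact_eq_bounded_closed)
      moreover have "a \<in> S"
        using \<open>a < b\<close> c by (auto simp: S_def)
      ultimately obtain s where s: "s \<in> S" "\<And>x. x \<in> S \<Longrightarrow> x \<le> s"
        using compact_attains_sup[of S] by blast
      have sb: "a \<le> s" "s < b" "g s \<le> c"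
        using s(1) c by (auto simp: S_def less_le)
      have above: "c < g x" if "s < x" "x \<le> b" for x
        using s(2)[of x] that sb by (force simp: S_def)
      have gs: "g s = c"
      proof (rule ccontr)
        assume "g s \<noteq> c"
        then have "g s < c" using sb by auto
        moreover have "continuous_on {s..b} g"
          using sb by (intro continuous_on_subset[OF contg]) auto
        ultimately obtain x where "s \<le> x" "x \<le> b" "g x = c"
          using IVT'[of g s c b] c sb by auto
        then show False
          using above[of x] \<open>g s < c\<close> by (cases "x = s") auto
      qed
      with c sb have "a < s" by (auto simp: less_le)
      obtain R where R: "(f has_real_derivative R) (at_right s)"
        "R = 0 \<or> (f has_real_derivative 0) (at_left s)"
        using right[of s] sb \<open>a < s\<close> by auto
      have "(g has_real_derivative (R - k)) (at_right s)"
        unfolding g_def using R(1) by (auto intro!: derivative_eq_intros)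
      have "R \<noteq> 0"
      proof
        assume "R = 0"
        then obtain d where d: "d > 0" "\<And>h. h > 0 \<Longrightarrow> h < d \<Longrightarrow> g s > g (s + h)"
          using has_real_derivative_neg_dec_right[OF \<open>(g has_real_derivative (R - k)) (at_right s)\<close>]
            \<open>k > 0\<close> by auto
        define h where "h = min (d / 2) (b - s)"
        have "h > 0" "h < d" "s + h \<le> b"
          using d(1) sb by (auto simp: h_def min_def)
        then show False
          using d(2)[of h] above[of "s + h"] gs by auto
      qed
      then have "(f has_real_derivative 0) (at_left s)"
        using R(2) by auto
      then have "(g has_real_derivative (0 - k)) (at_left s)"
        unfolding g_def by (auto intro!: derivative_eq_intros)
      then obtain d where d: "d > 0" "\<And>h. h > 0 \<Longrightarrow> h < d \<Longrightarrow> g s < g (s - h)"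
        using has_real_derivative_neg_dec_left[of g "0 - k" s "{..<s}"] \<open>k > 0\<close> by auto
      have "g s \<le> g x" if "x \<in> {s - d<..<b}" for x
        using that d(2)[of "s - x"] above[of x] gs by (cases x s rule: linorder_cases) auto
      then show "c \<in> {g s |s. \<exists>u v. u < s \<and> s < v \<and> (\<forall>x\<in>{u<..<v}. g s \<le> g x)}"
        using gs sb d(1)
        by (intro CollectI exI[of _ s] conjI exI[of _ "s - d"] exI[of _ b]) auto
    qed
    then have "countable {g a<..<g b}"
      using countable_local_min_values countable_subset by blast
    then show False
      using \<open>g a < g b\<close> uncountable_open_interval by blast
  qed
qed

section \<open>Inverses of rising functions and their slopes\<close>

text \<open>One-sided derivatives of increasing functions with values in \<open>[0, \<infinity>]\<close>. The value \<open>\<infinity>\<close> is needed: where a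
  capacity ratio reaches its maximum its left derivative may be 0, and then its inverse has infinite
  slope. With this convention the slope of an inverse is always the inverse of the slope. The filter
  \<open>F\<close> tells from which side \<open>x\<close> is approached. Negative difference quotients count as 0, so the notion
  is meaningful for increasing functions only.\<close>

definition has_slope :: "(real \<Rightarrow> real) \<Rightarrow> ennreal \<Rightarrow> real filter \<Rightarrow> real \<Rightarrow> bool" where
  "has_slope f D F x \<longleftrightarrow> ((\<lambda>y. ennreal ((f y - f x) / (y - x))) \<longlongrightarrow> D) F"

lemma has_slope_of_deriv:
  "(f has_real_derivative D) (at x within S) \<Longrightarrow> has_slope f (ennreal D) (at x within S) x"
  unfolding has_slope_def has_field_derivative_iff by (rule tendsto_ennrealI)

lemma deriv_of_has_slope:
  assumes "has_slope f (ennreal D) (at x within S) x" "D \<ge> 0"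
    and "\<forall>\<^sub>F y in at x within S. 0 \<le> (f y - f x) / (y - x)"
  shows "(f has_real_derivative D) (at x within S)"
proof -
  have "((\<lambda>y. enn2real (ennreal ((f y - f x) / (y - x)))) \<longlongrightarrow> D) (at x within S)"
    using assms(1,2) unfolding has_slope_def by (intro tendsto_enn2real) auto
  moreover have "\<forall>\<^sub>F y in at x within S.
      enn2real (ennreal ((f y - f x) / (y - x))) = (f y - f x) / (y - x)"
    using assms(3) by eventually_elim simp
  ultimately show ?thesis
    unfolding has_field_derivative_iff by (rule Lim_transform_eventually)
qed

lemma has_slope_inverse:
  assumes slope: "has_slope f D (at x within S) x"
    and lim: "filterlim g (at x within S) F"
    and inv: "\<forall>\<^sub>F y in F. f (g y) = y" "f x = y0" "g y0 = x"
    and pos: "\<forall>\<^sub>F y in F. 0 < (g y - x) / (y - y0)"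
  shows "has_slope g (inverse D) F y0"
proof -
  have "((\<lambda>y. ennreal ((f (g y) - f x) / (g y - x))) \<longlongrightarrow> D) F"
    using filterlim_compose[OF _ lim] slope unfolding has_slope_def by blast
  then have "((\<lambda>y. inverse (ennreal ((f (g y) - f x) / (g y - x)))) \<longlongrightarrow> inverse D) F"
    by (rule continuous_on_tendsto_compose
        [OF continuous_on_inverse_ennreal[OF continuous_on_id, of UNIV]]) auto
  moreover have "\<forall>\<^sub>F y in F. inverse (ennreal ((f (g y) - f x) / (g y - x))) =
      ennreal ((g y - g y0) / (y - y0))"
    using inv(1) pos
  proof eventually_elim
    case (elim y)
    then have "0 < (y - y0) / (g y - x)"
      by (auto simp: zero_less_divide_iff)
    then show ?case
      using elim inv(2,3) by (simp add: inverse_ennreal)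
  qed
  ultimately show ?thesis
    unfolding has_slope_def by (rule Lim_transform_eventually)
qed

text \<open>An increasing continuous \<open>f\<close> on \<open>[a, b]\<close> together with a left inverse \<open>g\<close>. The left inverse is a
  parameter, since in one use it is given beforehand: the optimal ratio inverts the total weight.\<close>

locale rising =
  fixes a b :: real and f g :: "real \<Rightarrow> real"
  assumes le: "a \<le> b" and cont: "continuous_on {a..b} f"
    and smono: "strict_mono_on {a..b} f"
    and left_inverse: "\<And>x. x \<in> {a..b} \<Longrightarrow> g (f x) = x"
begin

lemma f_less_iff: "x \<in> {a..b} \<Longrightarrow> y \<in> {a..b} \<Longrightarrow> f x < f y \<longleftrightarrow> x < y"
  using smono by (rule strict_mono_on_less)

lemma f_le_iff: "x \<in> {a..b} \<Longrightarrow> y \<in> {a..b} \<Longrightarrow> f x \<le> f y \<longleftrightarrow> x \<le> y"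
  using f_less_iff by (metis not_less)

lemma image_eq: "f ` {a..b} = {f a..f b}"
proof
  show "f ` {a..b} \<subseteq> {f a..f b}"
    using le by (auto simp: f_le_iff)
  show "{f a..f b} \<subseteq> f ` {a..b}"
    using IVT'[of f a _ b] le cont by fastforce
qed

lemma right_inverse: "y \<in> {f a..f b} \<Longrightarrow> f (g y) = y"
  and inverse_mem: "y \<in> {f a..f b} \<Longrightarrow> g y \<in> {a..b}"
  unfolding image_eq[symmetric] using left_inverse by auto

lemma cont_inverse: "continuous_on {f a..f b} g"
  unfolding image_eq[symmetric] using cont left_inverse by (intro continuous_on_inv) auto

lemma inverse_less_iff:
  "y \<in> {f a..f b} \<Longrightarrow> z \<in> {f a..f b} \<Longrightarrow> g y < g z \<longleftrightarrow> y < z"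
  using f_less_iff[of "g y" "g z"] inverse_mem right_inverse by simp

lemma has_slope_inverse_left:
  assumes x: "x \<in> {a<..b}" and slope: "has_slope f D (at_left x) x"
  shows "has_slope g (inverse D) (at_left (f x)) (f x)"
proof -
  have fx: "f a < f x" "f x \<le> f b"
    using x le by (auto simp: f_less_iff f_le_iff)
  have ev: "\<forall>\<^sub>F y in at_left (f x). y \<in> {f a<..<f x}"
    using eventually_at_left_real[OF fx(1)] .
  have gl: "g y < x" if "y \<in> {f a<..<f x}" for y
    using inverse_less_iff[of y "f x"] left_inverse[of x] that fx x by auto
  have "continuous_on {f a..f x} g"
    using fx by (intro continuous_on_subset[OF cont_inverse]) auto
  then have "(g \<longlongrightarrow> g (f x)) (at (f x) within {f a..f x})"
    using fx by (auto simp: continuous_on_def)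
  then have "(g \<longlongrightarrow> x) (at_left (f x))"
    using fx left_inverse[of x] x by (simp add: at_within_Icc_at_left)
  moreover have "\<forall>\<^sub>F y in at_left (f x). g y \<in> {..<x} \<and> g y \<noteq> x"
    using ev by eventually_elim (use gl in fastforce)
  ultimately have lim: "filterlim g (at_left x) (at_left (f x))"
    by (simp add: filterlim_at)
  show ?thesis
  proof (rule has_slope_inverse[OF slope lim _ refl])
    show "\<forall>\<^sub>F y in at_left (f x). f (g y) = y"
      using ev fx by (auto elim!: eventually_mono intro!: right_inverse)
    show "g (f x) = x"
      using left_inverse x by auto
    show "\<forall>\<^sub>F y in at_left (f x). 0 < (g y - x) / (y - f x)"
      using ev
    proof eventually_elim
      case (elim y)
      then show ?case
        using gl[of y] by (auto intro!: divide_neg_neg)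
    qed
  qed
qed

lemma has_slope_inverse_right:
  assumes x: "x \<in> {a..<b}" and slope: "has_slope f D (at_right x) x"
  shows "has_slope g (inverse D) (at_right (f x)) (f x)"
proof -
  have fx: "f a \<le> f x" "f x < f b"
    using x le by (auto simp: f_less_iff f_le_iff)
  have ev: "\<forall>\<^sub>F y in at_right (f x). y \<in> {f x<..<f b}"
    using eventually_at_right_real[OF fx(2)] .
  have gl: "x < g y" if "y \<in> {f x<..<f b}" for y
    using inverse_less_iff[of "f x" y] left_inverse[of x] that fx x by auto
  have "continuous_on {f x..f b} g"
    using fx by (intro continuous_on_subset[OF cont_inverse]) auto
  then have "(g \<longlongrightarrow> g (f x)) (at (f x) within {f x..f b})"
    using fx by (auto simp: continuous_on_def)
  then have "(g \<longlongrightarrow> x) (at_right (f x))"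
    using fx left_inverse[of x] x by (simp add: at_within_Icc_at_right)
  moreover have "\<forall>\<^sub>F y in at_right (f x). g y \<in> {x<..} \<and> g y \<noteq> x"
    using ev by eventually_elim (use gl in fastforce)
  ultimately have lim: "filterlim g (at_right x) (at_right (f x))"
    by (simp add: filterlim_at)
  show ?thesis
  proof (rule has_slope_inverse[OF slope lim _ refl])
    show "\<forall>\<^sub>F y in at_right (f x). f (g y) = y"
      using ev fx by (auto elim!: eventually_mono intro!: right_inverse)
    show "g (f x) = x"
      using left_inverse x by auto
    show "\<forall>\<^sub>F y in at_right (f x). 0 < (g y - x) / (y - f x)"
      using ev
    proof eventually_elim
      case (elim y)
      then show ?case
        using gl[of y] by auto
    qed
  qed
qed

end

text \<open>The inverse of a rising branch, extended by the constant \<open>a\<close> to all levels below \<open>f a\<close>. It is the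
  least \<open>x\<close> in \<open>[a, b]\<close> with \<open>z \<le> f x\<close>. Clamping the level keeps it continuous and monotone on
  \<open>{..f b}\<close>, so that inverses of branches with different ranges can be added.\<close>

definition branch_inverse :: "real \<Rightarrow> real \<Rightarrow> (real \<Rightarrow> real) \<Rightarrow> real \<Rightarrow> real" where
  "branch_inverse a b f z = the_inv_into {a..b} f (max z (f a))"

locale rising_branch =
  fixes a b :: real and f :: "real \<Rightarrow> real"
  assumes le: "a \<le> b" and cont: "continuous_on {a..b} f"
    and smono: "strict_mono_on {a..b} f"
begin

abbreviation "inv_f \<equiv> branch_inverse a b f"

sublocale rising a b f inv_f
proof
  fix x assume x: "x \<in> {a..b}"
  have "f a \<le> f x"
    using strict_mono_on_leD[OF smono, of a x] x by auto
  then show "inv_f (f x) = x"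
    unfolding branch_inverse_def
    using the_inv_into_f_f[OF strict_mono_on_imp_inj_on[OF smono] x] by (simp add: max_def)
qed (rule le cont smono)+

lemma ends_le: "f a \<le> f b"
  using f_le_iff[of a b] le by auto

lemma inv_clamp: "inv_f (max z (f a)) = inv_f z"
  by (simp add: branch_inverse_def)

lemma inv_low: "z \<le> f a \<Longrightarrow> inv_f z = a"
  using inv_clamp[of z] left_inverse[of a] le by (simp add: max_def)

lemma max_mem: "z \<le> f b \<Longrightarrow> max z (f a) \<in> {f a..f b}"
  using ends_le by auto

lemma inv_mem: "z \<le> f b \<Longrightarrow> inv_f z \<in> {a..b}"
  using inv_clamp[of z] inverse_mem[OF max_mem, of z] by simp

lemma f_inv: "z \<le> f b \<Longrightarrow> f (inv_f z) = max z (f a)"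
  using inv_clamp[of z] right_inverse[OF max_mem, of z] by simp

lemma le_f_iff: "z \<le> f b \<Longrightarrow> x \<in> {a..b} \<Longrightarrow> z \<le> f x \<longleftrightarrow> inv_f z \<le> x"
  using f_le_iff[of "inv_f z" x] f_le_iff[of a x] inv_mem[of z] f_inv[of z] by auto

lemma inv_less: "y < z \<Longrightarrow> z \<le> f b \<Longrightarrow> f a < z \<Longrightarrow> inv_f y < inv_f z"
  using inverse_less_iff[of "max y (f a)" "max z (f a)"] by (auto simp: inv_clamp)

lemma inv_mono: "y \<le> z \<Longrightarrow> z \<le> f b \<Longrightarrow> inv_f y \<le> inv_f z"
  using inv_less[of y z] inv_low[of y] inv_low[of z]
  by (cases "y < z \<and> f a < z") (auto simp: less_le)

lemma cont_inv: "continuous_on {..f b} inv_f"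
proof -
  have "continuous_on {..f b} (\<lambda>z. inv_f (max z (f a)))"
    using ends_le
    by (intro continuous_on_compose2[OF cont_inverse] continuous_intros) auto
  then show ?thesis
    by (simp add: inv_clamp)
qed

text \<open>The slope may be infinite only at the top level \<open>f b\<close>, where the left derivative of \<open>f\<close> may vanish, and
  it is 0 exactly where the inverse is clamped.\<close>

lemma inv_slope_left:
  assumes der: "\<And>x. x \<in> {a<..b} \<Longrightarrow>
      \<exists>D. (f has_real_derivative D) (at_left x) \<and> (x < b \<longrightarrow> 0 < D)"
    and z: "z \<le> f b"
  shows "\<exists>L. has_slope inv_f L (at_left z) z \<and> (f a < z \<longrightarrow> 0 < L) \<and> (z < f b \<longrightarrow> L < top)"
proof (cases "f a < z")
  case True
  have fz: "f (inv_f z) = z"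
    using f_inv[OF z] True by simp
  have mem: "inv_f z \<in> {a<..b}"
    using inv_mem[OF z] fz True by (cases "inv_f z = a") auto
  then obtain D where D: "(f has_real_derivative D) (at_left (inv_f z))" "inv_f z < b \<longrightarrow> 0 < D"
    using der by blast
  have "has_slope inv_f (inverse (ennreal D)) (at_left z) z"
    using has_slope_inverse_left[OF mem has_slope_of_deriv[OF D(1)]] fz by simp
  moreover have "inv_f z < b" if "z < f b"
    using f_less_iff[of "inv_f z" b] mem fz le that by auto
  ultimately show ?thesis
    using D(2) by (intro exI[of _ "inverse (ennreal D)"])
      (auto simp: ennreal_inverse_positive less_top[symmetric])
next
  case False
  have "\<forall>\<^sub>F y in at_left z. ennreal ((inv_f y - inv_f z) / (y - z)) = 0"
    using False by (auto simp: eventually_at_filter inv_low)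
  then have "has_slope inv_f 0 (at_left z) z"
    unfolding has_slope_def by (rule tendsto_eventually)
  then show ?thesis
    using False by (intro exI[of _ 0]) auto
qed

lemma inv_slope_right:
  assumes der: "\<And>x. x \<in> {a..<b} \<Longrightarrow> \<exists>D>0. (f has_real_derivative D) (at_right x)"
    and z: "z < f b"
  shows "\<exists>L<top. has_slope inv_f L (at_right z) z \<and> (f a \<le> z \<longrightarrow> 0 < L)"
proof (cases "f a \<le> z")
  case True
  have fz: "f (inv_f z) = z"
    using f_inv[of z] True z by simp
  have mem: "inv_f z \<in> {a..<b}"
    using inv_mem[of z] fz z by (cases "inv_f z = b") auto
  then obtain D where D: "(f has_real_derivative D) (at_right (inv_f z))" "0 < D"
    using der by blast
  have "has_slope inv_f (inverse (ennreal D)) (at_right z) z"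
    using has_slope_inverse_right[OF mem has_slope_of_deriv[OF D(1)]] fz by simp
  then show ?thesis
    using D(2) by (intro exI[of _ "inverse (ennreal D)"])
      (auto simp: ennreal_inverse_positive less_top[symmetric])
next
  case False
  have "\<forall>\<^sub>F y in at_right z. y \<in> {z<..<f a}"
    using False by (intro eventually_at_right_real) auto
  then have "\<forall>\<^sub>F y in at_right z. ennreal ((inv_f y - inv_f z) / (y - z)) = 0"
    by eventually_elim (use False in \<open>simp add: inv_low\<close>)
  then have "has_slope inv_f 0 (at_right z) z"
    unfolding has_slope_def by (rule tendsto_eventually)
  then show ?thesis
    using False by (intro exI[of _ 0]) auto
qed

end

text \<open>Each branch is inverted and the inverses are added; \<open>total z\<close> is the least sum of arguments
  at which all branches reach the level \<open>z\<close>. Levels matter between \<open>base\<close>, below which all inverses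
  are clamped, and \<open>peak\<close>, above which some branch does not reach the level.\<close>

locale rising_family =
  fixes l p :: "'n::finite \<Rightarrow> real" and f :: "'n \<Rightarrow> real \<Rightarrow> real"
  assumes branch: "\<And>i. rising_branch (l i) (p i) (f i)"
begin

abbreviation "inv_f i \<equiv> branch_inverse (l i) (p i) (f i)"

definition base :: real where "base = Min (range (\<lambda>i. f i (l i)))"

definition peak :: real where "peak = Min (range (\<lambda>i. f i (p i)))"

definition total :: "real \<Rightarrow> real" where "total z = (\<Sum>i\<in>UNIV. inv_f i z)"

lemma base_le: "base \<le> f i (l i)"
  unfolding base_def by (intro Min_le) auto

lemma peak_le: "peak \<le> f i (p i)"
  unfolding peak_def by (intro Min_le) auto

lemma le_peakI: "(\<And>i. z \<le> f i (p i)) \<Longrightarrow> z \<le> peak"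
  unfolding peak_def by (subst Min_ge_iff) auto

lemma base_attained: "\<exists>i. f i (l i) = base"
proof -
  have "base \<in> range (\<lambda>i. f i (l i))"
    unfolding base_def by (intro Min_in) auto
  then show ?thesis
    by auto
qed

lemma base_le_peak: "base \<le> peak"
  using le_peakI[of base] base_le rising_branch.ends_le[OF branch] order_trans by blast

lemma total_base: "total base = (\<Sum>i\<in>UNIV. l i)"
  unfolding total_def using rising_branch.inv_low[OF branch base_le] by simp

lemma total_mono: "y \<le> z \<Longrightarrow> z \<le> peak \<Longrightarrow> total y \<le> total z"
  unfolding total_def
  by (intro sum_mono rising_branch.inv_mono[OF branch]) (auto intro: order_trans[OF _ peak_le])

lemma cont_total: "continuous_on {base..peak} total"
  unfolding total_def
  by (intro continuous_on_sum continuous_on_subset[OF rising_branch.cont_inv[OF branch]])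
    (auto intro: order_trans[OF _ peak_le])

text \<open>The branch that starts at \<open>base\<close> is never clamped above that level, so at least one summand
  increases strictly.\<close>

lemma smono_total: "strict_mono_on {base..peak} total"
proof (rule strict_mono_onI)
  fix y z assume yz: "y \<in> {base..peak}" "z \<in> {base..peak}" "y < z"
  have le: "z \<le> f i (p i)" for i
    using yz(2) peak_le[of i] by auto
  obtain i where i: "f i (l i) = base"
    using base_attained by blast
  show "total y < total z"
    unfolding total_def
  proof (rule sum_strict_mono_ex1)
    show "\<forall>i\<in>UNIV. inv_f i y \<le> inv_f i z"
      using yz(3) le by (auto intro: rising_branch.inv_mono[OF branch])
    show "\<exists>i\<in>UNIV. inv_f i y < inv_f i z"
      using rising_branch.inv_less[OF branch yz(3) le, of i] i yz by auto
  qed simp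
qed

lemma rising_total:
  assumes "\<And>z. z \<in> {base..peak} \<Longrightarrow> g (total z) = z"
  shows "rising base peak total g"
  using base_le_peak cont_total smono_total assms by unfold_locales

lemma has_slope_total:
  assumes slope: "\<And>i. has_slope (inv_f i) (L i) F z"
    and ev: "\<forall>\<^sub>F y in F. y < z \<and> z \<le> peak \<or> z < y \<and> y \<le> peak"
  shows "has_slope total (\<Sum>i\<in>UNIV. L i) F z"
proof -
  have "((\<lambda>y. \<Sum>i\<in>UNIV. ennreal ((inv_f i y - inv_f i z) / (y - z))) \<longlongrightarrow> (\<Sum>i\<in>UNIV. L i)) F"
    using slope unfolding has_slope_def by (intro tendsto_sum)
  moreover have "\<forall>\<^sub>F y in F. (\<Sum>i\<in>UNIV. ennreal ((inv_f i y - inv_f i z) / (y - z))) =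
      ennreal ((total y - total z) / (y - z))"
    using ev
  proof eventually_elim
    case (elim y)
    have "0 \<le> (inv_f i y - inv_f i z) / (y - z)" for i
      using elim rising_branch.inv_mono[OF branch, of y z i]
        rising_branch.inv_mono[OF branch, of z y i] peak_le[of i]
      by (auto simp: zero_le_divide_iff)
    then show ?case
      by (simp add: total_def sum_subtractf flip: sum_divide_distrib)
  qed
  ultimately show ?thesis
    unfolding has_slope_def by (rule Lim_transform_eventually)
qed

lemma total_slope_left:
  assumes der: "\<And>i x. x \<in> {l i<..p i} \<Longrightarrow>
      \<exists>D. (f i has_real_derivative D) (at_left x) \<and> (x < p i \<longrightarrow> 0 < D)"
    and z: "z \<in> {base<..peak}"
  shows "\<exists>L>0. has_slope total L (at_left z) z \<and> (z < peak \<longrightarrow> L < top)"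
proof -
  have "\<exists>L. has_slope (inv_f i) L (at_left z) z \<and> (f i (l i) < z \<longrightarrow> 0 < L) \<and>
      (z < f i (p i) \<longrightarrow> L < top)" for i
    using z peak_le[of i] by (intro rising_branch.inv_slope_left[OF branch] der) auto
  then obtain L where L: "\<And>i. has_slope (inv_f i) (L i) (at_left z) z"
    "\<And>i. f i (l i) < z \<Longrightarrow> 0 < L i" "\<And>i. z < f i (p i) \<Longrightarrow> L i < top"
    by metis
  obtain i where "f i (l i) = base"
    using base_attained by blast
  then have "0 < L i"
    using L(2)[of i] z by auto
  then have "0 < (\<Sum>i\<in>UNIV. L i)"
    by (intro sum_pos2[of _ i]) auto
  moreover have "has_slope total (\<Sum>i\<in>UNIV. L i) (at_left z) z"
    using z by (intro has_slope_total L(1)) (auto simp: eventually_at_filter)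
  moreover have "(\<Sum>i\<in>UNIV. L i) < top" if "z < peak"
  proof -
    have "L i < top" for i
      using L(3) less_le_trans[OF that peak_le] by blast
    then show ?thesis
      by (auto simp: less_top[symmetric])
  qed
  ultimately show ?thesis
    by blast
qed

lemma total_slope_right:
  assumes der: "\<And>i x. x \<in> {l i..<p i} \<Longrightarrow> \<exists>D>0. (f i has_real_derivative D) (at_right x)"
    and z: "z \<in> {base..<peak}"
  shows "\<exists>L>0. has_slope total L (at_right z) z \<and> L < top"
proof -
  have lt: "z < f i (p i)" for i
    using z peak_le[of i] by auto
  have "\<exists>L<top. has_slope (inv_f i) L (at_right z) z \<and> (f i (l i) \<le> z \<longrightarrow> 0 < L)" for i
    using lt by (intro rising_branch.inv_slope_right[OF branch] der) auto
  then obtain L where L: "\<And>i. has_slope (inv_f i) (L i) (at_right z) z"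
    "\<And>i. f i (l i) \<le> z \<Longrightarrow> 0 < L i" "\<And>i. L i < top"
    by metis
  obtain i where "f i (l i) = base"
    using base_attained by blast
  then have "0 < L i"
    using L(2)[of i] z by auto
  then have "0 < (\<Sum>i\<in>UNIV. L i)"
    by (intro sum_pos2[of _ i]) auto
  moreover have "\<forall>\<^sub>F y in at_right z. y \<in> {z<..<peak}"
    using z by (intro eventually_at_right_real) auto
  then have "has_slope total (\<Sum>i\<in>UNIV. L i) (at_right z) z"
    by (intro has_slope_total L(1)) (auto elim!: eventually_mono)
  moreover have "(\<Sum>i\<in>UNIV. L i) < top"
    using L(3) by (auto simp: less_top[symmetric])
  ultimately show ?thesis
    by blast
qed

text \<open>The derivative of the inverse of \<open>total\<close> is the harmonic combination \<open>1 / (\<Sum>i. 1 / d i)\<close> of the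
  derivatives \<open>d i\<close> of the branches that are not clamped. The sum is positive because the branch
  starting at \<open>base\<close> contributes a positive term, so the derivative is finite. It vanishes only if
  some \<open>d i\<close> does, which can happen for left derivatives at the level \<open>peak\<close>.\<close>

lemma inverse_total_deriv_left:
  assumes der: "\<And>i x. x \<in> {l i<..p i} \<Longrightarrow>
      \<exists>D. (f i has_real_derivative D) (at_left x) \<and> (x < p i \<longrightarrow> 0 < D)"
    and g: "\<And>z. z \<in> {base..peak} \<Longrightarrow> g (total z) = z"
    and w: "w \<in> {total base<..total peak}"
  shows "\<exists>D\<ge>0. (g has_real_derivative D) (at_left w) \<and> (w < total peak \<longrightarrow> 0 < D)"
proof -
  interpret rising base peak total g
    using g by (rule rising_total)
  define z where "z = g w"
  have zw: "total z = w" "z \<in> {base..peak}"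
    unfolding z_def using right_inverse[of w] inverse_mem[of w] w by auto
  then have z: "z \<in> {base<..peak}"
    using w by (cases "z = base") auto
  obtain L where L: "L > 0" "has_slope total L (at_left z) z" "z < peak \<longrightarrow> L < top"
    using total_slope_left[OF der z] by blast
  have slope: "has_slope g (inverse L) (at_left w) w"
    using has_slope_inverse_left[OF z L(2)] zw by simp
  have "inverse L < top"
    using L(1) by (simp add: less_top[symmetric])
  then obtain D where D: "D \<ge> 0" "inverse L = ennreal D"
    by (cases "inverse L") auto
  have "\<forall>\<^sub>F y in at_left w. y \<in> {total base<..<w}"
    using w by (intro eventually_at_left_real) auto
  then have "\<forall>\<^sub>F y in at_left w. 0 \<le> (g y - g w) / (y - w)"
  proof eventually_elim
    case (elim y)
    then show ?case
      using inverse_less_iff[of y w] w by (auto simp: zero_le_divide_iff)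
  qed
  then have "(g has_real_derivative D) (at_left w)"
    using slope D by (intro deriv_of_has_slope) auto
  moreover have "0 < D" if "w < total peak"
  proof -
    have "z < peak"
      using that zw by (cases "z = peak") auto
    then have "0 < inverse L"
      using L(3) by (simp add: ennreal_inverse_positive)
    then show ?thesis
      using D by simp
  qed
  ultimately show ?thesis
    using D(1) by blast
qed

lemma inverse_total_deriv_right:
  assumes der: "\<And>i x. x \<in> {l i..<p i} \<Longrightarrow> \<exists>D>0. (f i has_real_derivative D) (at_right x)"
    and g: "\<And>z. z \<in> {base..peak} \<Longrightarrow> g (total z) = z"
    and w: "w \<in> {total base..<total peak}"
  shows "\<exists>D>0. (g has_real_derivative D) (at_right w)"
proof -
  interpret rising base peak total g
    using g by (rule rising_total)
  define z where "z = g w"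
  have zw: "total z = w" "z \<in> {base..peak}"
    unfolding z_def using right_inverse[of w] inverse_mem[of w] w by auto
  then have z: "z \<in> {base..<peak}"
    using w by (cases "z = peak") auto
  obtain L where L: "L > 0" "has_slope total L (at_right z) z" "L < top"
    using total_slope_right[OF der z] by blast
  have slope: "has_slope g (inverse L) (at_right w) w"
    using has_slope_inverse_right[OF z L(2)] zw by simp
  have "inverse L < top"
    using L(1) by (simp add: less_top[symmetric])
  then obtain D where D: "D \<ge> 0" "inverse L = ennreal D"
    by (cases "inverse L") auto
  have "\<forall>\<^sub>F y in at_right w. y \<in> {w<..<total peak}"
    using w by (intro eventually_at_right_real) auto
  then have "\<forall>\<^sub>F y in at_right w. 0 \<le> (g y - g w) / (y - w)"
  proof eventually_elim
    case (elim y)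
    then show ?case
      using inverse_less_iff[of w y] w by (auto simp: zero_le_divide_iff)
  qed
  then have "(g has_real_derivative D) (at_right w)"
    using slope D by (intro deriv_of_has_slope) auto
  moreover have "0 < inverse L"
    using L(3) by (simp add: ennreal_inverse_positive)
  ultimately show ?thesis
    using D by auto
qed

end

section \<open>Links in parallel\<close>

lemma one_sided_derivs_eq:
  assumes "x < xu" and right: "(\<psi> has_real_derivative R) (at_right x)"
    and left: "xl < x \<Longrightarrow> (\<psi> has_real_derivative L) (at_left x)"
  shows "one_sided_derivs xl xu \<psi> x = (if xl < x then {L, R} else {R})"
proof -
  have R_unique: "D = R" if "(\<psi> has_real_derivative D) (at_right x)" for D
    using that right unfolding has_field_derivative_iff
    using tendsto_unique[OF trivial_limit_at_right_real] by metis
  have L_unique: "D = L" if "xl < x" "(\<psi> has_real_derivative D) (at_left x)" for D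
    using that(2) left[OF that(1)] unfolding has_field_derivative_iff
    using tendsto_unique[OF trivial_limit_at_left_real] by metis
  have "D \<in> one_sided_derivs xl xu \<psi> x \<longleftrightarrow> xl < x \<and> D = L \<or> D = R" for D
    unfolding one_sided_derivs_def using R_unique[of D] L_unique[of D] left right assms(1) by blast
  then show ?thesis
    by (intro set_eqI) simp
qed

text \<open>Parallel links whose capacity ratios \<open>r i x = c i x / x\<close> rise strictly on \<open>[wl i, p i]\<close>, are constant on
  \<open>[p i, q i]\<close> and fall strictly on \<open>[q i, wu i]\<close>.\<close>

locale peaked_network =
  fixes wl wu :: "real ^ 'n::finite" and c r :: "'n \<Rightarrow> real \<Rightarrow> real" and p q :: "'n \<Rightarrow> real"
  assumes wl_pos: "\<And>i. 0 < wl $ i"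
    and wl_le_p: "\<And>i. wl $ i \<le> p i" and p_le_q: "\<And>i. p i \<le> q i" and q_le_wu: "\<And>i. q i \<le> wu $ i"
    and r_eq: "\<And>i x. r i x = c i x / x"
    and r_cont: "\<And>i. continuous_on {wl $ i..wu $ i} (r i)"
    and r_inc: "\<And>i. strict_mono_on {wl $ i..p i} (r i)"
    and r_flat: "\<And>i x. x \<in> {p i..q i} \<Longrightarrow> r i x = r i (p i)"
    and r_dec: "\<And>i. strict_antimono_on {q i..wu $ i} (r i)"
begin

sublocale up: rising_family "\<lambda>i. wl $ i" p r
proof
  fix i
  show "continuous_on {wl $ i..p i} (r i)"
    using p_le_q[of i] q_le_wu[of i] by (auto intro: continuous_on_subset[OF r_cont])
qed (rule wl_le_p r_inc)+

text \<open>The falling branches, read from right to left.\<close>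

sublocale down: rising_family "\<lambda>i. - wu $ i" "\<lambda>i. - q i" "\<lambda>i x. r i (- x)"
proof
  fix i
  show "- wu $ i \<le> - q i"
    using q_le_wu by simp
  show "continuous_on {- wu $ i..- q i} (\<lambda>x. r i (- x))"
    using wl_le_p[of i] p_le_q[of i]
    by (intro continuous_on_compose2[OF r_cont] continuous_intros) auto
  show "strict_mono_on {- wu $ i..- q i} (\<lambda>x. r i (- x))"
    by (intro strict_mono_onI monotone_onD[OF r_dec]) auto
qed

abbreviation "lo \<equiv> up.inv_f"
definition hi :: "'n \<Rightarrow> real \<Rightarrow> real" where "hi i z = - down.inv_f i z"
abbreviation "M \<equiv> up.peak"
abbreviation "lo_total \<equiv> up.total"
definition hi_total :: "real \<Rightarrow> real" where "hi_total z = (\<Sum>i\<in>UNIV. hi i z)"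
abbreviation "wl_total \<equiv> \<Sum>i\<in>UNIV. wl $ i"
abbreviation "wu_total \<equiv> \<Sum>i\<in>UNIV. wu $ i"

definition best :: "real \<Rightarrow> real" where "best W = (GREATEST z. z \<in> feasible_ratios wl wu c W)"

lemma hi_total_eq: "hi_total z = - down.total z"
  by (simp add: hi_total_def hi_def down.total_def sum_negf)

lemma r_q: "r i (q i) = r i (p i)"
  using r_flat[of "q i" i] p_le_q[of i] by auto

lemma down_peak: "down.peak = M"
  by (simp add: down.peak_def up.peak_def r_q)

lemma M_le: "z \<le> M \<Longrightarrow> z \<le> r i (p i)"
  using up.peak_le order_trans by blast

lemma r_le_peak:
  assumes "x \<in> {wl $ i..wu $ i}"
  shows "r i x \<le> r i (p i)"
proof -
  consider "x \<le> p i" | "x \<in> {p i..q i}" | "q i < x"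
    by fastforce
  then show ?thesis
  proof cases
    case 1
    then show ?thesis
      using strict_mono_on_leD[OF r_inc, of x i "p i"] assms wl_le_p[of i] by auto
  next
    case 3
    then show ?thesis
      using monotone_onD[OF r_dec, of "q i" i x] assms q_le_wu[of i] r_q by auto
  next
    case 2
    then show ?thesis
      using r_flat[of x i] by simp
  qed
qed

lemma lo_mem: "z \<le> M \<Longrightarrow> lo i z \<in> {wl $ i..p i}"
  using rising_branch.inv_mem[OF up.branch M_le] .

lemma hi_mem: "z \<le> M \<Longrightarrow> hi i z \<in> {q i..wu $ i}"
  using rising_branch.inv_mem[OF down.branch, of z i] M_le[of z i] r_q by (auto simp: hi_def)

lemma r_hi: "z \<le> M \<Longrightarrow> r i (hi i z) = max z (r i (wu $ i))"
  using rising_branch.f_inv[OF down.branch, of z i] M_le[of z i] r_q by (simp add: hi_def)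

lemma hi_antimono: "y \<le> z \<Longrightarrow> z \<le> M \<Longrightarrow> hi i z \<le> hi i y"
  using rising_branch.inv_mono[OF down.branch, of y z i] M_le[of z i] r_q by (simp add: hi_def)

text \<open>Unimodality: the superlevel sets of a ratio are intervals, bounded by the two branch inverses.\<close>

lemma superlevel_iff:
  assumes z: "z \<le> M" and x: "x \<in> {wl $ i..wu $ i}"
  shows "z \<le> r i x \<longleftrightarrow> x \<in> {lo i z..hi i z}"
proof -
  note le = M_le[OF z, of i]
  consider "x < p i" | "x \<in> {p i..q i}" | "q i < x"
    by fastforce
  then show ?thesis
  proof cases
    case 1
    then show ?thesis
      using rising_branch.le_f_iff[OF up.branch, of z i x] le x hi_mem[OF z, of i] p_le_q[of i]
      by auto
  next
    case 2
    then show ?thesis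
      using lo_mem[OF z, of i] hi_mem[OF z, of i] le r_flat[OF 2] by auto
  next
    case 3
    then have "z \<le> r i (- (- x)) \<longleftrightarrow> down.inv_f i z \<le> - x"
      using le x r_q by (intro rising_branch.le_f_iff[OF down.branch]) auto
    then show ?thesis
      using 3 lo_mem[OF z, of i] p_le_q[of i] by (auto simp: hi_def)
  qed
qed

lemma lo_total_le_hi_total: "z \<le> M \<Longrightarrow> lo_total z \<le> hi_total z"
  unfolding up.total_def hi_total_def
proof (rule sum_mono)
  fix i assume "z \<le> M"
  then show "lo i z \<le> hi i z"
    using lo_mem[of z i] hi_mem[of z i] p_le_q[of i] by auto
qed

text \<open>The superlevel intervals \<open>[lo i z, hi i z]\<close> of the links add up to the interval of the total weights at
  which the ratio \<open>z\<close> is attainable. This reduces the optimisation over weight vectors to a comparison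
  of two sums.\<close>

lemma feasible_iff:
  "z \<in> feasible_ratios wl wu c W \<longleftrightarrow> z \<le> M \<and> W \<in> {lo_total z..hi_total z}"
proof
  assume "z \<in> feasible_ratios wl wu c W"
  then obtain w where w: "\<And>i. w $ i \<in> {wl $ i..wu $ i}" "\<And>i. z \<le> r i (w $ i)"
    "(\<Sum>i\<in>UNIV. w $ i) = W"
    by (auto simp: feasible_ratios_def r_eq)
  have z: "z \<le> M"
    using w r_le_peak by (intro up.le_peakI) (blast intro: order_trans)
  then have "\<And>i. w $ i \<in> {lo i z..hi i z}"
    using superlevel_iff[OF z] w by blast
  then show "z \<le> M \<and> W \<in> {lo_total z..hi_total z}"
    using z by (auto simp: up.total_def hi_total_def simp flip: w(3) intro!: sum_mono)
next
  assume *: "z \<le> M \<and> W \<in> {lo_total z..hi_total z}"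
  then have z: "z \<le> M" by simp
  \<comment> \<open>Interpolate between the extreme weights by the fraction that gives the total \<open>W\<close>; the guard
    covers the case that the interval of totals is a single point.\<close>
  define t where "t = (if hi_total z = lo_total z then 0
    else (W - lo_total z) / (hi_total z - lo_total z))"
  have t: "0 \<le> t" "t \<le> 1" "lo_total z + t * (hi_total z - lo_total z) = W"
    using * by (auto simp: t_def)
  define w :: "real ^ 'n" where "w = (\<chi> i. lo i z + t * (hi i z - lo i z))"
  have w: "w $ i \<in> {lo i z..hi i z}" for i
  proof -
    have le: "lo i z \<le> hi i z"
      using lo_mem[OF z, of i] hi_mem[OF z, of i] p_le_q[of i] by auto
    then have "t * (hi i z - lo i z) \<le> hi i z - lo i z"
      using t by (intro mult_left_le_one_le) auto
    then show ?thesis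
      using t le by (auto simp: w_def)
  qed
  have mem: "w $ i \<in> {wl $ i..wu $ i}" for i
    using lo_mem[OF z, of i] hi_mem[OF z, of i] w[of i] by simp
  then have "z \<le> r i (w $ i)" for i
    using superlevel_iff[OF z] w by blast
  moreover have "0 < w $ i" for i
    using mem[of i] wl_pos[of i] by auto
  moreover have "(\<Sum>i\<in>UNIV. w $ i) = W"
    unfolding t(3)[symmetric]
    by (simp add: w_def up.total_def hi_total_def sum.distrib sum_subtractf flip: sum_distrib_left)
  ultimately show "z \<in> feasible_ratios wl wu c W"
    using mem unfolding feasible_ratios_def r_eq by auto
qed

lemma hi_total_smono: "down.base \<le> y \<Longrightarrow> y < z \<Longrightarrow> z \<le> M \<Longrightarrow> hi_total z < hi_total y"
  using strict_mono_onD[OF down.smono_total, of y z] by (simp add: hi_total_eq down_peak)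

lemma hi_total_base: "hi_total down.base = wu_total"
  by (simp add: hi_total_eq down.total_base sum_negf)

definition is_best :: "real \<Rightarrow> real \<Rightarrow> bool" where
  "is_best W z \<longleftrightarrow> z \<in> feasible_ratios wl wu c W \<and> (\<forall>z'\<in>feasible_ratios wl wu c W. z' \<le> z)"

lemma best_eq: "is_best W z \<Longrightarrow> best W = z"
  unfolding is_best_def best_def by (intro Greatest_equality) auto

lemma is_best_rising:
  assumes "z \<in> {up.base..M}"
  shows "is_best (lo_total z) z"
proof -
  have "z' \<le> z" if "z' \<in> feasible_ratios wl wu c (lo_total z)" for z'
  proof (rule ccontr)
    assume "\<not> z' \<le> z"
    then have "lo_total z < lo_total z'"
      using that assms strict_mono_onD[OF up.smono_total, of z z'] by (auto simp: feasible_iff)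
    then show False
      using that by (auto simp: feasible_iff)
  qed
  then show ?thesis
    using assms lo_total_le_hi_total by (auto simp: is_best_def feasible_iff)
qed

lemma is_best_flat:
  "W \<in> {lo_total M..hi_total M} \<Longrightarrow> is_best W M"
  by (auto simp: is_best_def feasible_iff)

lemma is_best_falling:
  assumes "z \<in> {down.base..M}"
  shows "is_best (hi_total z) z"
proof -
  have "z' \<le> z" if "z' \<in> feasible_ratios wl wu c (hi_total z)" for z'
  proof (rule ccontr)
    assume "\<not> z' \<le> z"
    then have "hi_total z' < hi_total z"
      using that assms hi_total_smono[of z z'] by (auto simp: feasible_iff)
    then show False
      using that by (auto simp: feasible_iff)
  qed
  then show ?thesis
    using assms lo_total_le_hi_total by (auto simp: is_best_def feasible_iff)
qed

text \<open>The optimal ratio inverts \<open>lo_total\<close> on \<open>[wl_total, lo_total M]\<close>, is constantly \<open>M\<close> up to \<open>hi_total M\<close>, and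
  inverts \<open>hi_total\<close> beyond.\<close>

lemma best_rising: "z \<in> {up.base..M} \<Longrightarrow> best (lo_total z) = z"
  by (intro best_eq is_best_rising)

lemma best_flat: "W \<in> {lo_total M..hi_total M} \<Longrightarrow> best W = M"
  by (intro best_eq is_best_flat)

lemma best_falling: "z \<in> {down.base..M} \<Longrightarrow> best (hi_total z) = z"
  by (intro best_eq is_best_falling)

sublocale rise: rising up.base M lo_total best
  using best_rising by (rule up.rising_total)

sublocale fall: rising down.base down.peak down.total "\<lambda>w. best (- w)"
  using best_falling by (intro down.rising_total) (auto simp: hi_total_eq down_peak)

lemma risingE:
  assumes "W \<in> {wl_total..lo_total M}"
  obtains z where "z \<in> {up.base..M}" "W = lo_total z"
  using rise.image_eq assms up.total_base by (metis imageE)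

lemma fallingE:
  assumes "W \<in> {hi_total M..wu_total}"
  obtains z where "z \<in> {down.base..M}" "W = hi_total z"
proof -
  have "- W \<in> down.total ` {down.base..M}"
    using fall.image_eq assms hi_total_base by (simp add: hi_total_eq down_peak)
  then show thesis
    using that by (force simp: hi_total_eq)
qed

lemma totals_le: "wl_total \<le> lo_total M" "lo_total M \<le> hi_total M" "hi_total M \<le> wu_total"
proof -
  show "wl_total \<le> lo_total M"
    using up.total_mono[OF up.base_le_peak order_refl] by (simp add: up.total_base)
  show "hi_total M \<le> wu_total"
    using down.total_mono[OF down.base_le_peak order_refl]
    by (simp add: hi_total_eq down_peak flip: hi_total_base)
qed (simp add: lo_total_le_hi_total)

lemma is_best_best:
  assumes "W \<in> {wl_total..wu_total}"
  shows "is_best W (best W)"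
proof -
  have "\<exists>z. is_best W z"
  proof -
    consider "W \<in> {wl_total..lo_total M}" | "W \<in> {lo_total M..hi_total M}" |
      "W \<in> {hi_total M..wu_total}"
      using assms by fastforce
    then show ?thesis
    proof cases
      case 1
      then show ?thesis
        using is_best_rising by (elim risingE) auto
    next
      case 2
      then show ?thesis
        using is_best_flat by blast
    next
      case 3
      then show ?thesis
        using is_best_falling by (elim fallingE) auto
    qed
  qed
  then show ?thesis
    using best_eq by auto
qed

lemma best_le_M: "W \<in> {wl_total..wu_total} \<Longrightarrow> best W \<le> M"
  using is_best_best[of W] by (simp add: is_best_def feasible_iff)

lemma continuous_on_best: "continuous_on {wl_total..wu_total} best"
proof -
  have 1: "continuous_on {wl_total..lo_total M} best"
    using rise.cont_inverse by (simp add: up.total_base)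
  have 2: "continuous_on {lo_total M..hi_total M} best"
    using continuous_on_cong[OF refl, of "{lo_total M..hi_total M}" best "\<lambda>_. M"] best_flat by simp
  have "continuous_on {hi_total M..wu_total} (\<lambda>W. best (- (- W)))"
    by (intro continuous_on_compose2[OF fall.cont_inverse] continuous_intros)
      (auto simp: hi_total_eq down_peak simp flip: hi_total_base)
  then have 3: "continuous_on {hi_total M..wu_total} best"
    by simp
  have "{wl_total..wu_total} =
      {wl_total..lo_total M} \<union> ({lo_total M..hi_total M} \<union> {hi_total M..wu_total})"
    using totals_le by auto
  then show ?thesis
    using 1 2 3 by (simp only:) (intro continuous_on_closed_Un closed_Un closed_real_atLeastAtMost)
qed

lemma best_mono:
  assumes "W \<in> {wl_total..W'}" "W' \<le> hi_total M"
  shows "best W \<le> best W'"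
proof (cases "W' \<le> lo_total M")
  case True
  then show ?thesis
    using rise.inverse_less_iff[of W' W] assms by (auto simp: up.total_base)
next
  case False
  then show ?thesis
    using best_le_M[of W] best_flat[of W'] assms totals_le by auto
qed

lemma best_deriv_zero:
  assumes "W \<in> {lo_total M..hi_total M}"
    and "\<forall>\<^sub>F y in at W within S. y \<in> {lo_total M..hi_total M}"
  shows "(best has_real_derivative 0) (at W within S)"
proof -
  have "\<forall>\<^sub>F y in at W within S. (best y - best W) / (y - W) = 0"
    using assms(2) by eventually_elim (simp add: best_flat best_flat[OF assms(1)])
  then show ?thesis
    unfolding has_field_derivative_iff by (rule tendsto_eventually)
qed

end

text \<open>The properties of the capacities beyond the shape of their ratios: each \<open>c i\<close> is constant on \<open>[q i, s i]\<close>
  and falls strictly on \<open>[s i, wu i]\<close>, and each ratio has positive one-sided derivatives on its rising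
  branch, except possibly the left one at \<open>p i\<close>.\<close>

locale s1_network = peaked_network wl wu c r p q
  for wl wu :: "real ^ 'n::finite" and c r :: "'n \<Rightarrow> real \<Rightarrow> real" and p q :: "'n \<Rightarrow> real" +
  fixes s :: "'n \<Rightarrow> real"
  assumes q_le_s: "\<And>i. q i \<le> s i" and s_le_wu: "\<And>i. s i \<le> wu $ i"
    and c_pos: "\<And>i x. x \<in> {wl $ i..wu $ i} \<Longrightarrow> 0 < c i x"
    and c_flat: "\<And>i x. x \<in> {q i..s i} \<Longrightarrow> c i x = c i (q i)"
    and c_dec: "\<And>i. strict_antimono_on {s i..wu $ i} (c i)"
    and r_left: "\<And>i x. x \<in> {wl $ i<..p i} \<Longrightarrow>
      \<exists>D. (r i has_real_derivative D) (at_left x) \<and> (x < p i \<longrightarrow> 0 < D)"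
    and r_right: "\<And>i x. x \<in> {wl $ i..<p i} \<Longrightarrow> \<exists>D>0. (r i has_real_derivative D) (at_right x)"
begin

abbreviation "C \<equiv> equivalent_capacity wl wu c"

lemma C_eq: "C W = W * best W"
  by (simp add: equivalent_capacity_def best_def)

lemma wl_le_wu: "wl $ i \<le> wu $ i"
  using wl_le_p[of i] p_le_q[of i] q_le_wu[of i] by simp

lemma r_pos: "x \<in> {wl $ i..wu $ i} \<Longrightarrow> 0 < r i x"
  using c_pos[of x i] wl_pos[of i] by (auto simp: r_eq)

lemma base_pos: "0 < up.base" "0 < down.base"
proof -
  obtain i j where "r i (wl $ i) = up.base" "r j (wu $ j) = down.base"
    using up.base_attained down.base_attained by auto
  then show "0 < up.base" "0 < down.base"
    using r_pos[of "wl $ i" i] r_pos[of "wu $ j" j] wl_le_wu[of i] wl_le_wu[of j] by auto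
qed

lemma wl_total_pos: "0 < wl_total"
  using wl_pos by (intro sum_pos) auto

lemma best_pos:
  assumes "W \<in> {wl_total..hi_total M}"
  shows "0 < best W"
proof -
  have "best wl_total = up.base"
    using best_rising[of up.base] up.base_le_peak by (simp add: up.total_base)
  then show ?thesis
    using best_mono[of wl_total W] assms base_pos by auto
qed

lemma C_smono: "strict_mono_on {wl_total..hi_total M} C"
proof (rule strict_mono_onI)
  fix W W' assume "W \<in> {wl_total..hi_total M}" "W' \<in> {wl_total..hi_total M}" "W < W'"
  then show "C W < C W'"
    unfolding C_eq using best_mono[of W W'] best_pos[of W] wl_total_pos
    by (intro mult_less_le_imp_less) auto
qed

text \<open>What a link contributes to the equivalent capacity beyond \<open>hi_total M\<close>, as a function of the optimal ratio
  \<open>z\<close>, which falls from \<open>M\<close> as the total weight grows. The contribution stays at the maximal capacity of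
  the link until \<open>z\<close> falls to the ratio at \<open>s i\<close>, and decreases strictly from then on.\<close>

definition flow :: "'n \<Rightarrow> real \<Rightarrow> real" where "flow i z = z * hi i z"

lemma C_hi_total:
  assumes "z \<in> {down.base..M}"
  shows "C (hi_total z) = (\<Sum>i\<in>UNIV. flow i z)"
proof -
  have "C (hi_total z) = z * hi_total z"
    by (simp add: C_eq best_falling[OF assms])
  then show ?thesis
    by (simp add: hi_total_def flow_def sum_distrib_left)
qed

lemma hi_pos: "z \<le> M \<Longrightarrow> 0 < hi i z"
  using hi_mem[of z i] wl_pos[of i] wl_le_p[of i] p_le_q[of i] by auto

lemma s_mem: "s i \<in> {q i..wu $ i}"
  using q_le_s s_le_wu by simp

lemma r_wu_le: "x \<in> {q i..wu $ i} \<Longrightarrow> r i (wu $ i) \<le> r i x"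
  using monotone_onD[OF r_dec, of x i "wu $ i"] by (cases "x = wu $ i") (auto simp: less_imp_le)

lemma flow_const:
  assumes "r i (s i) \<le> z" "z \<le> M"
  shows "flow i z = c i (q i)"
proof -
  have rz: "r i (hi i z) = z"
    using r_hi[OF assms(2), of i] r_wu_le[OF s_mem, of i] assms(1) by simp
  have "hi i z \<le> s i"
  proof (rule ccontr)
    assume "\<not> hi i z \<le> s i"
    then have "r i (hi i z) < r i (s i)"
      using hi_mem[OF assms(2), of i] s_mem[of i] by (intro monotone_onD[OF r_dec]) auto
    then show False
      using rz assms(1) by simp
  qed
  then have "c i (hi i z) = c i (q i)"
    using hi_mem[OF assms(2), of i] by (intro c_flat) auto
  moreover have "flow i z = c i (hi i z)"
    using rz hi_pos[OF assms(2), of i] by (auto simp: flow_def r_eq divide_eq_eq)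
  ultimately show ?thesis
    by simp
qed

text \<open>If the weight of the link still moves when \<open>z\<close> decreases to \<open>y\<close>, then it moves on the falling branch of
  \<open>c i\<close>. If it does not, it is saturated at its upper bound, and the contribution is proportional to the
  ratio.\<close>

lemma flow_smono:
  assumes "0 < y" "y < z" "z \<le> M" "z \<le> r i (s i)"
  shows "flow i y < flow i z"
proof (cases "hi i z = hi i y")
  case True
  then show ?thesis
    using assms hi_pos[of z i] by (simp add: flow_def)
next
  case False
  have y: "y \<le> M" using assms by simp
  have lt: "hi i z < hi i y"
    using False hi_antimono[of y z i] assms by auto
  have z_le: "z \<le> r i (hi i z)" and y_le: "y \<le> r i (hi i y)"
    using r_hi[of z i] r_hi[of y i] assms y by auto
  have "r i (hi i z) = z"
  proof (rule ccontr)
    assume "r i (hi i z) \<noteq> z"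
    then have "r i (hi i z) = r i (wu $ i)"
      using r_hi[of z i] assms by (auto simp: max_def split: if_splits)
    moreover have "r i (wu $ i) < r i (hi i z)"
      using lt hi_mem[of z i] hi_mem[of y i] assms y by (intro monotone_onD[OF r_dec]) auto
    ultimately show False
      by simp
  qed
  then have flow_z: "flow i z = c i (hi i z)"
    using hi_pos[of z i] assms by (auto simp: flow_def r_eq divide_eq_eq)
  have "s i \<le> hi i z"
    using superlevel_iff[of z "s i" i] assms s_mem[of i] wl_le_p[of i] p_le_q[of i] by auto
  then have "c i (hi i y) < c i (hi i z)"
    using lt hi_mem[of y i] hi_mem[of z i] assms y by (intro monotone_onD[OF c_dec]) auto
  moreover have "flow i y \<le> c i (hi i y)"
    using y_le hi_pos[OF y, of i] by (simp add: flow_def r_eq le_divide_eq)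
  ultimately show ?thesis
    using flow_z by simp
qed

lemma flow_mono:
  assumes "0 < y" "y \<le> z" "z \<le> M"
  shows "flow i y \<le> flow i z"
proof -
  consider "y = z" | "r i (s i) \<le> y" | "y < z" "z \<le> r i (s i)" | "y < r i (s i)" "r i (s i) < z"
    using assms by linarith
  then show ?thesis
  proof cases
    case 2
    then show ?thesis
      using assms by (simp add: flow_const)
  next
    case 3
    then show ?thesis
      using flow_smono[of y z i] assms by simp
  next
    case 4
    then have "flow i y < flow i (r i (s i))"
      using assms by (intro flow_smono) auto
    also have "\<dots> = flow i z"
      using 4 assms by (simp add: flow_const)
    finally show ?thesis
      by simp
  qed simp
qed

text \<open>The ratio at which the equivalent capacity starts to fall: below it some contribution decreases. The
  minimum with \<open>M\<close> covers the case that a contribution falls right from \<open>hi_total M\<close> on; the constant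
  part is then a single point.\<close>

definition knee :: real where "knee = min M (Max (range (\<lambda>i. r i (s i))))"

lemma knee_mem: "knee \<in> {down.base..M}"
proof -
  obtain i where "r i (wu $ i) = down.base"
    using down.base_attained by auto
  then have "down.base \<le> r i (s i)"
    using r_wu_le[OF s_mem, of i] by simp
  also have "\<dots> \<le> Max (range (\<lambda>i. r i (s i)))"
    by (intro Max_ge) auto
  finally show ?thesis
    using down.base_le_peak by (simp add: knee_def down_peak)
qed

lemma hi_total_less_iff:
  "y \<in> {down.base..M} \<Longrightarrow> z \<in> {down.base..M} \<Longrightarrow> hi_total z < hi_total y \<longleftrightarrow> y < z"
  using hi_total_smono[of y z] hi_total_smono[of z y] by (cases y z rule: linorder_cases) auto

lemma hi_total_knee: "hi_total knee \<in> {hi_total M..wu_total}"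
  using hi_total_less_iff[of knee M] hi_total_less_iff[of down.base knee] knee_mem hi_total_base
  by (auto simp: not_less[symmetric])

lemma C_const: "C constant_on {hi_total M..hi_total knee}"
  unfolding constant_on_def
proof (intro exI ballI)
  fix W assume W: "W \<in> {hi_total M..hi_total knee}"
  then have "W \<in> {hi_total M..wu_total}"
    using hi_total_knee by simp
  then obtain z where z: "z \<in> {down.base..M}" "W = hi_total z"
    by (rule fallingE)
  have "knee \<le> z"
    using hi_total_less_iff[of z knee] z W knee_mem by auto
  show "C W = C (hi_total M)"
  proof (cases "z = M")
    case False
    then have "M \<noteq> min M (Max (range (\<lambda>i. r i (s i))))"
      using \<open>knee \<le> z\<close> z(1) by (auto simp: knee_def)
    then have "Max (range (\<lambda>i. r i (s i))) \<le> z"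
      using \<open>knee \<le> z\<close> by (simp only: knee_def min_def split: if_splits)
    then have "r i (s i) \<le> z" for i
      by simp
    then have "flow i z = flow i M" for i
      using z(1) flow_const[of i z] flow_const[of i M] order_trans[of "r i (s i)" z M] by auto
    then show ?thesis
      using z C_hi_total[of z] C_hi_total[of M] by auto
  qed (use z in simp)
qed

lemma C_smono_falling: "strict_antimono_on {hi_total knee..wu_total} C"
proof (rule monotone_onI)
  fix W W' assume W: "W \<in> {hi_total knee..wu_total}" "W' \<in> {hi_total knee..wu_total}" "W < W'"
  have mem: "W \<in> {hi_total M..wu_total}" "W' \<in> {hi_total M..wu_total}"
    using W(1,2) hi_total_knee by simp_all
  obtain z where z: "z \<in> {down.base..M}" "W = hi_total z"
    using mem(1) by (rule fallingE)
  obtain z' where z': "z' \<in> {down.base..M}" "W' = hi_total z'"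
    using mem(2) by (rule fallingE)
  have lt: "z' < z"
    using W(3) hi_total_less_iff[of z' z] z z' by simp
  have le: "z \<le> knee"
    using W(1) hi_total_less_iff[of knee z] z knee_mem by auto
  have "Max (range (\<lambda>i. r i (s i))) \<in> range (\<lambda>i. r i (s i))"
    by (intro Max_in) auto
  then obtain i where "r i (s i) = Max (range (\<lambda>i. r i (s i)))"
    by (metis (mono_tags, lifting) imageE)
  then have i: "z \<le> r i (s i)"
    using le by (simp add: knee_def)
  have pos: "0 < z'"
    using z' base_pos by auto
  have "(\<Sum>i\<in>UNIV. flow i z') < (\<Sum>i\<in>UNIV. flow i z)"
  proof (rule sum_strict_mono_ex1)
    show "\<forall>i\<in>UNIV. flow i z' \<le> flow i z"
      using flow_mono pos lt z by auto
    show "\<exists>i\<in>UNIV. flow i z' < flow i z"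
      using flow_smono[OF pos lt _ i] z by auto
  qed simp
  then show "C W' < C W"
    using z z' by (simp add: C_hi_total)
qed

lemma transitions: "S0_transitions wl_total wu_total C (hi_total M) (hi_total knee)"
  unfolding S0_transitions_def
  using totals_le hi_total_knee C_smono C_const C_smono_falling by auto

lemma S0_C: "S0 wl_total wu_total C"
proof -
  have "continuous_on {wl_total..wu_total} (\<lambda>W. W * best W)"
    by (intro continuous_intros continuous_on_best)
  then have "continuous_on {wl_total..wu_total} C"
    by (simp add: C_eq[abs_def])
  then show ?thesis
    using transitions by (auto simp: S0_def)
qed

lemma best_left:
  assumes W: "W \<in> {wl_total<..hi_total M}"
  shows "\<exists>D\<ge>0. (best has_real_derivative D) (at_left W) \<and> (W < lo_total M \<longrightarrow> 0 < D)"
proof (cases "W \<le> lo_total M")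
  case True
  then show ?thesis
    using W by (intro up.inverse_total_deriv_left[OF r_left best_rising])
      (simp_all add: up.total_base)
next
  case False
  then have "\<forall>\<^sub>F y in at_left W. y \<in> {lo_total M<..<W}"
    by (intro eventually_at_left_real) auto
  then have "\<forall>\<^sub>F y in at_left W. y \<in> {lo_total M..hi_total M}"
    by eventually_elim (use W in auto)
  then show ?thesis
    using best_deriv_zero[of W "{..<W}"] W False by auto
qed

lemma best_right:
  assumes W: "W \<in> {wl_total..<hi_total M}"
  shows "\<exists>D\<ge>0. (best has_real_derivative D) (at_right W) \<and> (if W < lo_total M then 0 < D else D = 0)"
proof (cases "W < lo_total M")
  case True
  then have "\<exists>D>0. (best has_real_derivative D) (at_right W)"
    using W by (intro up.inverse_total_deriv_right[OF r_right best_rising])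
      (simp_all add: up.total_base)
  then show ?thesis
    using True by (auto intro: less_imp_le)
next
  case False
  have "\<forall>\<^sub>F y in at_right W. y \<in> {W<..<hi_total M}"
    using W by (intro eventually_at_right_real) auto
  then have "\<forall>\<^sub>F y in at_right W. y \<in> {lo_total M..hi_total M}"
    by eventually_elim (use False in auto)
  then show ?thesis
    using best_deriv_zero[of W "{W<..}"] W False by auto
qed

lemma C_deriv:
  "(best has_real_derivative D) (at W within S) \<Longrightarrow>
    (C has_real_derivative (best W + W * D)) (at W within S)"
  unfolding C_eq[abs_def] by (auto intro!: derivative_eq_intros)

text \<open>With \<open>C W = W * best W\<close>, a one-sided derivative of \<open>C\<close> exceeds \<open>C W / W\<close> by \<open>W\<close> times the one-sided
  derivative of the optimal ratio. The latter is positive before \<open>lo_total M\<close> and 0 between \<open>lo_total M\<close>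
  and \<open>hi_total M\<close>, except that the left derivative at \<open>lo_total M\<close> itself may be positive; the right one is 0
  there, which suffices for the minimum.\<close>

lemma S1_C: "S1 wl_total wu_total C"
proof -
  have derivs: "\<exists>L R. one_sided_derivs wl_total wu_total C W =
      (if wl_total < W then {best W + W * L, best W + W * R} else {best W + W * R}) \<and>
      (wl_total < W \<longrightarrow> 0 \<le> L \<and> (W < lo_total M \<longrightarrow> 0 < L)) \<and>
      (if W < lo_total M then 0 < R else R = 0)"
    if W: "W \<in> {wl_total..<hi_total M}" for W
  proof -
    obtain R where R: "(best has_real_derivative R) (at_right W)"
      "if W < lo_total M then 0 < R else R = 0"
      using best_right[OF W] by blast
    obtain L where L: "wl_total < W \<Longrightarrow> (best has_real_derivative L) (at_left W)"
      "wl_total < W \<longrightarrow> 0 \<le> L \<and> (W < lo_total M \<longrightarrow> 0 < L)"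
      using best_left[of W] W by (cases "wl_total < W") auto
    show ?thesis
      using one_sided_derivs_eq[OF _ C_deriv[OF R(1)] C_deriv[OF L(1)], of wu_total wl_total]
        W totals_le R(2) L(2) by (intro exI[of _ L] exI[of _ R]) auto
  qed
  have quot: "C W / W = best W" "0 < W" if "W \<in> {wl_total..<hi_total M}" for W
    using that wl_total_pos by (auto simp: C_eq)
  have "C W / W < Min (one_sided_derivs wl_total wu_total C W)"
    if "W \<in> {wl_total..<lo_total M}" for W
    using derivs[of W] quot[of W] that totals_le by auto
  moreover have "Min (one_sided_derivs wl_total wu_total C W) = C W / W"
    if "W \<in> {lo_total M..<hi_total M}" for W
    using derivs[of W] quot[of W] that totals_le by (auto simp: min_def mult_le_0_iff)
  moreover have "lo_total M \<in> {wl_total..hi_total M}"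
    using totals_le by simp
  moreover have "\<exists>D. (C has_real_derivative D) (at_left W)" if "W \<in> {wl_total<..hi_total M}" for W
    using best_left[OF that] C_deriv by blast
  moreover have "\<exists>D. (C has_real_derivative D) (at_right W)" if "W \<in> {wl_total..<hi_total M}" for W
    using best_right[OF that] C_deriv by blast
  ultimately show ?thesis
    unfolding S1_def using wl_total_pos S0_C transitions by blast
qed

end

section \<open>Capacity ratios of \<open>S1\<close> functions\<close>

lemma ratio_deriv:
  fixes \<psi> :: "real \<Rightarrow> real"
  assumes "(\<psi> has_real_derivative D) (at x within S)" "x \<noteq> 0"
  shows "((\<lambda>x. \<psi> x / x) has_real_derivative (D - \<psi> x / x) / x) (at x within S)"
proof -
  have "((\<lambda>x. \<psi> x / x) has_real_derivative (D * x - \<psi> x * 1) / (x * x)) (at x within S)"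
    using assms by (intro DERIV_divide DERIV_ident)
  moreover have "(D * x - \<psi> x * 1) / (x * x) = (D - \<psi> x / x) / x"
    using assms(2) by (simp add: field_simps)
  ultimately show ?thesis
    by simp
qed

text \<open>The derivative of \<open>\<psi> x / x\<close> is a positive multiple of \<open>D - \<psi> x / x\<close>, so the conditions on
  \<open>min \<partial>\<psi>\<close> make the ratio rise strictly up to \<open>p = x\<^sup>o\<close> and keep it constant from there to the
  first maximiser \<open>q\<close> of \<open>\<psi>\<close>. From \<open>q\<close> on \<open>\<psi>\<close> no longer increases while \<open>x\<close> does, so the positive
  ratio falls strictly.\<close>

lemma S1_ratio:
  assumes S1: "S1 l u \<psi>" and pos: "\<And>x. x \<in> {l..u} \<Longrightarrow> 0 < \<psi> x"
  defines "r \<equiv> \<lambda>x. \<psi> x / x"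
  obtains p q s where "l \<le> p" "p \<le> q" "q \<le> s" "s \<le> u"
    "continuous_on {l..u} r" "strict_mono_on {l..p} r" "\<And>x. x \<in> {p..q} \<Longrightarrow> r x = r p"
    "strict_antimono_on {q..u} r"
    "\<And>x. x \<in> {q..s} \<Longrightarrow> \<psi> x = \<psi> q" "strict_antimono_on {s..u} \<psi>"
    "\<And>x. x \<in> {l<..p} \<Longrightarrow> \<exists>D. (r has_real_derivative D) (at_left x) \<and> (x < p \<longrightarrow> 0 < D)"
    "\<And>x. x \<in> {l..<p} \<Longrightarrow> \<exists>D>0. (r has_real_derivative D) (at_right x)"
proof -
  obtain q s p where l: "0 < l" and cont: "continuous_on {l..u} \<psi>"
    and tr: "S0_transitions l u \<psi> q s" and p: "p \<in> {l..q}"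
    and left: "\<And>x. x \<in> {l<..q} \<Longrightarrow> \<exists>D. (\<psi> has_real_derivative D) (at_left x)"
    and right: "\<And>x. x \<in> {l..<q} \<Longrightarrow> \<exists>D. (\<psi> has_real_derivative D) (at_right x)"
    and rise: "\<And>x. x \<in> {l..<p} \<Longrightarrow> \<psi> x / x < Min (one_sided_derivs l u \<psi> x)"
    and flat: "\<And>x. x \<in> {p..<q} \<Longrightarrow> Min (one_sided_derivs l u \<psi> x) = \<psi> x / x"
    using S1 unfolding S1_def S0_def by blast
  have order: "l \<le> p" "p \<le> q" "q \<le> s" "s \<le> u"
    and const: "\<psi> constant_on {q..s}" and anti: "strict_antimono_on {s..u} \<psi>"
    using tr p by (auto simp: S0_transitions_def)
  have \<psi>_flat: "\<psi> x = \<psi> q" if "x \<in> {q..s}" for x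
    using const that order by (force simp: constant_on_def)
  have cont_r: "continuous_on {l..u} r"
    unfolding r_def using l by (intro continuous_intros cont) auto
  have der_r: "(r has_real_derivative (D - \<psi> x / x) / x) (at x within S)"
    if "(\<psi> has_real_derivative D) (at x within S)" "l \<le> x" for D x S
    unfolding r_def using that l by (intro ratio_deriv) auto
  have derivs: "\<exists>L R. one_sided_derivs l u \<psi> x = (if l < x then {L, R} else {R}) \<and>
      (\<psi> has_real_derivative R) (at_right x) \<and> (l < x \<longrightarrow> (\<psi> has_real_derivative L) (at_left x))"
    if x: "x \<in> {l..<q}" for x
  proof -
    obtain R where R: "(\<psi> has_real_derivative R) (at_right x)"
      using right[OF x] by blast
    obtain L where L: "l < x \<Longrightarrow> (\<psi> has_real_derivative L) (at_left x)"
      using left[of x] x by (cases "l < x") auto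
    show ?thesis
      using one_sided_derivs_eq[OF _ R L, of u l] x order R L
      by (intro exI[of _ L] exI[of _ R]) auto
  qed
  have r_left: "\<exists>D. (r has_real_derivative D) (at_left x) \<and> (x < p \<longrightarrow> 0 < D)"
    if x: "x \<in> {l<..p}" for x
  proof (cases "x < p")
    case True
    then obtain L where L: "(\<psi> has_real_derivative L) (at_left x)" "\<psi> x / x < L"
      using derivs[of x] rise[of x] x order by auto
    then show ?thesis
      using der_r[OF L(1)] x l by (intro exI[of _ "(L - \<psi> x / x) / x"]) auto
  next
    case False
    then show ?thesis
      using left[of x] der_r x order by force
  qed
  have r_right: "\<exists>D>0. (r has_real_derivative D) (at_right x)" if x: "x \<in> {l..<p}" for x
  proof -
    obtain R where R: "(\<psi> has_real_derivative R) (at_right x)" "\<psi> x / x < R"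
      using derivs[of x] rise[of x] x order by (auto split: if_splits)
    then show ?thesis
      using der_r[OF R(1)] x l by (intro exI[of _ "(R - \<psi> x / x) / x"]) auto
  qed
  have r_inc: "strict_mono_on {l..p} r"
  proof (rule pos_right_deriv_imp_strict_mono_on)
    show "continuous_on {l..p} r"
      using order by (auto intro: continuous_on_subset[OF cont_r])
  qed (rule r_right)
  have r_flat: "r x = r p" if x: "x \<in> {p..q}" for x
  proof (rule sym, rule zero_one_sided_deriv_imp_eq[of p x r])
    show "continuous_on {p..x} r"
      using order x by (auto intro: continuous_on_subset[OF cont_r])
    fix y assume y: "y \<in> {p..<x}"
    then have "y \<in> {l..<q}"
      using x order by auto
    then obtain L R where LR: "one_sided_derivs l u \<psi> y = (if l < y then {L, R} else {R})"
      "(\<psi> has_real_derivative R) (at_right y)"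
      "l < y \<Longrightarrow> (\<psi> has_real_derivative L) (at_left y)"
      using derivs by blast
    have Min: "Min (one_sided_derivs l u \<psi> y) = \<psi> y / y"
      using flat y x by auto
    define D where "D = (R - \<psi> y / y) / y"
    have "\<psi> y / y \<le> R" and min: "R = \<psi> y / y \<or> l < y \<and> L = \<psi> y / y"
      using Min LR(1) by (auto simp: min_def split: if_splits)
    then have "0 \<le> D"
      using y order l by (simp add: D_def)
    moreover have "(r has_real_derivative D) (at_right y)"
      unfolding D_def using LR(2) y order by (intro der_r) auto
    moreover have "D = 0 \<or> y = p \<or> (r has_real_derivative 0) (at_left y)"
      using min der_r[of L y "{..<y}"] LR(3) by (auto simp: D_def)
    ultimately show "\<exists>R\<ge>0. (r has_real_derivative R) (at_right y) \<and>
        (R = 0 \<or> y = p \<or> (r has_real_derivative 0) (at_left y))"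
      by blast
  qed (use x in simp)
  have r_dec: "strict_antimono_on {q..u} r"
  proof (rule monotone_onI)
    fix x y assume xy: "x \<in> {q..u}" "y \<in> {q..u}" "x < y"
    have "\<psi> y \<le> \<psi> x"
    proof (cases "y \<le> s")
      case True
      then show ?thesis
        using \<psi>_flat[of x] \<psi>_flat[of y] xy by simp
    next
      case False
      then have "\<psi> y < \<psi> (max x s)"
        using xy order by (intro monotone_onD[OF anti]) auto
      also have "\<psi> (max x s) = \<psi> x"
        using \<psi>_flat[of x] \<psi>_flat[of s] xy order by (auto simp: max_def)
      finally show ?thesis
        by simp
    qed
    moreover have "0 < x" "0 < \<psi> y"
      using pos[of y] xy order l by auto
    ultimately show "r y < r x"
      using xy(3) unfolding r_def by (intro frac_less2) auto
  qed
  show thesis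
    by (rule that[OF order cont_r r_inc r_flat r_dec \<psi>_flat anti r_left r_right])
qed

section \<open>Closure under parallel composition\<close>

theorem lemma11:
  fixes wl wu :: "real ^ 'n::finite"
    and c :: "'n \<Rightarrow> real \<Rightarrow> real"
  assumes wl_pos: "\<And>i. 0 < wl $ i"
    and wl_le_wu: "\<And>i. wl $ i \<le> wu $ i"
    and c_pos: "\<And>i x. x \<in> {wl $ i..wu $ i} \<Longrightarrow> 0 < c i x"
    and c_S1: "\<And>i. S1 (wl $ i) (wu $ i) (c i)"
  shows "(\<forall>weq \<in> {(\<Sum>i\<in>UNIV. wl $ i)..(\<Sum>i\<in>UNIV. wu $ i)}.
            \<exists>z \<in> feasible_ratios wl wu c weq. \<forall>z' \<in> feasible_ratios wl wu c weq. z' \<le> z) \<and>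
         S1 (\<Sum>i\<in>UNIV. wl $ i) (\<Sum>i\<in>UNIV. wu $ i) (equivalent_capacity wl wu c)"
proof -
  define r where "r = (\<lambda>i x. c i x / x)"
  \<comment> \<open>Collects the conclusions about one link, so that the break points can be chosen for all links
    at once.\<close>
  define ok where "ok = (\<lambda>i p q s. wl $ i \<le> p \<and> p \<le> q \<and> q \<le> s \<and> s \<le> wu $ i \<and>
    continuous_on {wl $ i..wu $ i} (r i) \<and> strict_mono_on {wl $ i..p} (r i) \<and>
    (\<forall>x\<in>{p..q}. r i x = r i p) \<and> strict_antimono_on {q..wu $ i} (r i) \<and>
    (\<forall>x\<in>{q..s}. c i x = c i q) \<and> strict_antimono_on {s..wu $ i} (c i) \<and>
    (\<forall>x\<in>{wl $ i<..p}. \<exists>D. (r i has_real_derivative D) (at_left x) \<and> (x < p \<longrightarrow> 0 < D)) \<and>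
    (\<forall>x\<in>{wl $ i..<p}. \<exists>D>0. (r i has_real_derivative D) (at_right x)))"
  have "\<exists>p q s. ok i p q s" for i
    unfolding ok_def r_def by (rule S1_ratio[OF c_S1[of i] c_pos[of _ i]]) blast+
  then obtain p q s where ok: "\<And>i. ok i (p i) (q i) (s i)"
    by metis
  interpret s1_network wl wu c r p q s
  proof
    fix i
    note props = ok[of i, unfolded ok_def]
    show "q i \<le> wu $ i"
      using props by linarith
    show "r i x = c i x / x" for x
      by (simp add: r_def)
    show "0 < c i x" if "x \<in> {wl $ i..wu $ i}" for x
      using that by (rule c_pos)
  qed (use ok in \<open>unfold ok_def, blast intro: wl_pos\<close>)+
  show ?thesis
    using is_best_best S1_C unfolding is_best_def by blast
qed

end
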